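(* Let $N\ge 2$ and let $\Omega\subset\mathbb{R}^N$ be a bounded domain with boundary of class $C^2$. Let $f\in C^1(\mathbb{R})$ be a function that changes sign, and let $\xi\in\mathbb{R}$ be a root of $f$ (that is, $f(\xi)=0$) such that $$f(t)(t-\xi)\le 0\qquad\text{for all } t\in\mathbb{R}.$$ Then any classical solution $u$ of $$-\Delta u=f(u)\ \text{ in }\Omega,\qquad u_\nu=0\ \text{ on }\partial\Omega,$$ is constant in $\overline\Omega$.
   Context: A domain is a connected open set. $\nu$ denotes the outward unit normal to $\partial\Omega$ and $u_\nu$ the derivative of $u$ in the direction $\nu$. A classical solution is a function $u\in C^2(\Omega)\cap C^1(\overline\Omega)$ satisfying the equation and the boundary condition pointwise. "$f$ changes sign" means that $f$ takes both positive and negative values. *)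

theory Defs
  imports "HOL-Analysis.Analysis"
begin

section \<open>The spaces $C^k(S)$ and $C^k(\overline S)$\<close>

definition partial_deriv :: "'a::euclidean_space \<Rightarrow> ('a \<Rightarrow> real) \<Rightarrow> 'a \<Rightarrow> real" where
  "partial_deriv b u = (\<lambda>x. frechet_derivative u (at x) b)"

text \<open>Intended for open \<open>S\<close>: the derivatives are taken in the full space.\<close>

primrec Ck_on :: "nat \<Rightarrow> 'a::euclidean_space set \<Rightarrow> ('a \<Rightarrow> real) \<Rightarrow> bool" where
  "Ck_on 0 S u \<longleftrightarrow> continuous_on S u"
| "Ck_on (Suc k) S u \<longleftrightarrow>
     (\<forall>x\<in>S. u differentiable (at x)) \<and> (\<forall>b\<in>Basis. Ck_on k S (partial_deriv b u))"

text \<open>Only the values of \<open>u\<close> on the closure of \<open>S\<close> matter: the first-order partial derivatives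
  on the open set \<open>S\<close> are required to extend continuously to the closure.\<close>

definition C1_on_closure :: "'a::euclidean_space set \<Rightarrow> ('a \<Rightarrow> real) \<Rightarrow> bool" where
  "C1_on_closure S u \<longleftrightarrow>
     Ck_on 1 S u \<and> continuous_on (closure S) u \<and>
     (\<forall>b\<in>Basis. \<exists>g. continuous_on (closure S) g \<and> (\<forall>x\<in>S. g x = partial_deriv b u x))"

definition laplacian :: "('a::euclidean_space \<Rightarrow> real) \<Rightarrow> 'a \<Rightarrow> real" where
  "laplacian u x = (\<Sum>b\<in>Basis. partial_deriv b (partial_deriv b u) x)"


section \<open>Boundary regularity and the outward unit normal\<close>

text \<open>Near each boundary point the set is the region strictly above the graph of a \<open>C\<^sup>k\<close> function,
  in rotated coordinates whose last axis is \<open>e\<close>. A function of the remaining \<open>N - 1\<close> coordinates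
  is encoded as a function \<open>\<gamma>\<close> on the whole space that is evaluated only at the orthogonal
  projection of \<open>x\<close> to the hyperplane orthogonal to \<open>e\<close>.\<close>

definition Ck_boundary :: "nat \<Rightarrow> 'a::euclidean_space set \<Rightarrow> bool" where
  "Ck_boundary k S \<longleftrightarrow>
     (\<forall>p\<in>frontier S. \<exists>r>0. \<exists>e \<gamma>. norm e = 1 \<and> Ck_on k UNIV \<gamma> \<and>
        S \<inter> ball p r = {x \<in> ball p r. \<gamma> (x - (x \<bullet> e) *\<^sub>R e) < x \<bullet> e})"

definition tangent_vectors :: "'a::euclidean_space set \<Rightarrow> 'a \<Rightarrow> 'a set" where
  "tangent_vectors M p =
     {v. \<exists>c. \<exists>\<epsilon>>0. c C1_differentiable_on {-\<epsilon><..<\<epsilon>} \<and> c ` {-\<epsilon><..<\<epsilon>} \<subseteq> M \<and>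
           c 0 = p \<and> (c has_vector_derivative v) (at 0)}"

definition is_outward_unit_normal :: "'a::euclidean_space set \<Rightarrow> 'a \<Rightarrow> 'a \<Rightarrow> bool" where
  "is_outward_unit_normal S p n \<longleftrightarrow>
     norm n = 1 \<and>
     (\<forall>v\<in>tangent_vectors (frontier S) p. n \<bullet> v = 0) \<and>
     (\<exists>\<delta>>0. \<forall>t. 0 < t \<and> t < \<delta> \<longrightarrow> p + t *\<^sub>R n \<notin> closure S)"

text \<open>At every boundary point of a set with \<open>C\<^sup>1\<close> boundary there is exactly one such vector.\<close>

definition outward_unit_normal :: "'a::euclidean_space set \<Rightarrow> 'a \<Rightarrow> 'a" where
  "outward_unit_normal S p = (THE n. is_outward_unit_normal S p n)"

text \<open>Since \<open>u\<close> is only meaningful on the closure of \<open>S\<close>, the derivative at a boundary point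
  in the outward direction is one-sided, taken from within \<open>S\<close>. For \<open>u\<close> in \<open>C\<^sup>1\<close> up to a \<open>C\<^sup>1\<close>
  boundary it exists and equals the inner product of the normal with the continuous
  extension of the gradient.\<close>

definition has_normal_derivative ::
    "('a::euclidean_space \<Rightarrow> real) \<Rightarrow> real \<Rightarrow> 'a set \<Rightarrow> 'a \<Rightarrow> bool" where
  "has_normal_derivative u d S p \<longleftrightarrow>
     ((\<lambda>t. u (p + t *\<^sub>R outward_unit_normal S p)) has_real_derivative d) (at_left 0)"

definition changes_sign :: "(real \<Rightarrow> real) \<Rightarrow> bool" where
  "changes_sign f \<longleftrightarrow> (\<exists>t. f t > 0) \<and> (\<exists>t. f t < 0)"


section \<open>Classical solutions of the Neumann problem\<close>

definition classical_neumann_solution ::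
    "(real \<Rightarrow> real) \<Rightarrow> 'a::euclidean_space set \<Rightarrow> ('a \<Rightarrow> real) \<Rightarrow> bool" where
  "classical_neumann_solution f S u \<longleftrightarrow>
     Ck_on 2 S u \<and> C1_on_closure S u \<and>
     (\<forall>x\<in>S. - laplacian u x = f (u x)) \<and>
     (\<forall>p\<in>frontier S. has_normal_derivative u 0 S p)"

end

theory Submission
  imports Defs
begin

text \<open>The function \<open>v = (u - \<xi>)\<^sup>2\<close> is subharmonic, because
  \<open>\<Delta>v = 2|\<nabla>u|\<^sup>2 - 2 (u - \<xi>) f(u) \<ge> 0\<close>. If its maximum over the closure were attained only on the
  boundary, Hopf's lemma in an interior ball touching the boundary at that point would make the normal
  derivative of \<open>v\<close> nonzero, whereas it equals \<open>2 (u - \<xi>) \<partial>u/\<partial>\<nu> = 0\<close>. So the maximum is attained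
  inside, \<open>v\<close> is constant by the strong maximum principle, and \<open>u\<close> takes at most two values on a
  connected set.\<close>

section \<open>Directional derivatives\<close>

lemma has_real_derivative_along_line:
  fixes u :: "'a::euclidean_space \<Rightarrow> real"
  assumes "u differentiable (at (x + s *\<^sub>R h))"
  shows "((\<lambda>t. u (x + t *\<^sub>R h)) has_real_derivative frechet_derivative u (at (x + s *\<^sub>R h)) h) (at s)"
proof -
  let ?D = "frechet_derivative u (at (x + s *\<^sub>R h))"
  have D: "(u has_derivative ?D) (at (x + s *\<^sub>R h))"
    using assms frechet_derivative_works by blast
  have "((\<lambda>t. x + t *\<^sub>R h) has_derivative (\<lambda>t. t *\<^sub>R h)) (at s)"
    by (auto intro!: derivative_eq_intros)
  from diff_chain_at[OF this D]
  have "((\<lambda>t. u (x + t *\<^sub>R h)) has_derivative (\<lambda>t. ?D (t *\<^sub>R h))) (at s)"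
    by (simp add: o_def)
  moreover have "(\<lambda>t. ?D (t *\<^sub>R h)) = (\<lambda>t. ?D h * t)"
    using linear_cmul[OF has_derivative_linear[OF D]] by (simp add: fun_eq_iff mult.commute)
  ultimately show ?thesis
    by (simp add: has_field_derivative_def)
qed

lemma frechet_derivative_eq_sum_partial_deriv:
  fixes u :: "'a::euclidean_space \<Rightarrow> real"
  assumes "u differentiable (at x)"
  shows "frechet_derivative u (at x) h = (\<Sum>b\<in>Basis. (h \<bullet> b) * partial_deriv b u x)"
proof -
  have lin: "linear (frechet_derivative u (at x))"
    using assms by (rule linear_frechet_derivative)
  have "frechet_derivative u (at x) h = frechet_derivative u (at x) (\<Sum>b\<in>Basis. (h \<bullet> b) *\<^sub>R b)"
    by (simp add: euclidean_representation)
  also have "\<dots> = (\<Sum>b\<in>Basis. (h \<bullet> b) * partial_deriv b u x)"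
    by (simp add: linear_sum[OF lin] linear_cmul[OF lin] partial_deriv_def)
  finally show ?thesis .
qed

section \<open>Second-order calculus along lines\<close>

text \<open>If \<open>d\<close> were positive, \<open>g'\<close> would be positive just to the right
  of its zero at \<open>0\<close>, and the mean value theorem would lift \<open>g\<close> above its
  maximum. Asking for \<open>g''\<close> only at \<open>0\<close> suits functions known through
  unmixed derivatives.\<close>

lemma second_derivative_nonpos_at_local_max:
  fixes g g' :: "real \<Rightarrow> real"
  assumes "\<delta> > 0"
    and max: "\<And>s. \<bar>s\<bar> < \<delta> \<Longrightarrow> g s \<le> g 0"
    and g': "\<And>s. \<bar>s\<bar> < \<delta> \<Longrightarrow> (g has_real_derivative g' s) (at s)"
    and g'': "(g' has_real_derivative d) (at 0)"
  shows "d \<le> 0"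
proof (rule ccontr)
  assume "\<not> d \<le> 0"
  then obtain e where e: "e > 0" "\<And>h. 0 < h \<Longrightarrow> h < e \<Longrightarrow> g' 0 < g' (0 + h)"
    using DERIV_pos_inc_right[OF g''] by force
  have "g' 0 = 0"
    using DERIV_local_max[OF g'[of 0] \<open>\<delta> > 0\<close>] max \<open>\<delta> > 0\<close> by auto
  define s where "s = min e \<delta> / 2"
  have s: "0 < s" "s < e" "s < \<delta>" using e \<open>\<delta> > 0\<close> by (auto simp: s_def)
  obtain z where z: "0 < z" "z < s" "g s - g 0 = (s - 0) * g' z"
    using MVT2[of 0 s g g'] g' s by force
  have "g' z > 0" using e(2)[of z] z s \<open>g' 0 = 0\<close> by auto
  then have "g s > g 0" using z s by (metis diff_gt_0_iff_gt diff_zero mult_pos_pos)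
  then show False using max[of s] s by auto
qed

text \<open>Taylor's formula: the mean value theorem applied twice along the segment from
  \<open>q\<close> to \<open>q + h\<close>, with second derivatives bounded on the compact unit
  ball. The quadratic order of the error is what lets a ball touch the graph of
  \<open>\<gamma>\<close> from one side.\<close>

lemma second_order_remainder_bound:
  fixes \<gamma> :: "'a::euclidean_space \<Rightarrow> real"
  assumes C2: "Ck_on 2 UNIV \<gamma>"
  shows "\<exists>K>0. \<forall>h. norm h \<le> 1 \<longrightarrow>
    \<bar>\<gamma> (q + h) - \<gamma> q - frechet_derivative \<gamma> (at q) h\<bar> \<le> K * (norm h)\<^sup>2"
proof -
  have dif: "\<gamma> differentiable (at x)" for x
    using C2 by (simp add: numeral_2_eq_2)
  have dif2: "partial_deriv b \<gamma> differentiable (at x)" if "b \<in> Basis" for b x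
    using C2 that by (simp add: numeral_2_eq_2)
  have cont: "continuous_on UNIV (partial_deriv c (partial_deriv b \<gamma>))" if "b \<in> Basis" "c \<in> Basis" for b c
    using C2 that by (simp add: numeral_2_eq_2)
  \<comment> \<open>\<open>H h x\<close> is the Hessian form of \<open>\<gamma>\<close> at
    \<open>x\<close> evaluated at \<open>(h, h)\<close>.\<close>
  define H where "H = (\<lambda>h x. \<Sum>b\<in>Basis. (h \<bullet> b) * (\<Sum>c\<in>Basis. (h \<bullet> c) * partial_deriv c (partial_deriv b \<gamma>) x))"
  have "\<exists>B. \<forall>x\<in>cball q 1. \<bar>partial_deriv c (partial_deriv b \<gamma>) x\<bar> \<le> B"
    if "b \<in> Basis" "c \<in> Basis" for b c
    using compact_continuous_image[OF continuous_on_subset[OF cont[OF that]], of "cball q 1"]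
    by (auto dest!: compact_imp_bounded simp: bounded_iff)
  then obtain B where B: "\<And>b c x. b \<in> Basis \<Longrightarrow> c \<in> Basis \<Longrightarrow> x \<in> cball q 1 \<Longrightarrow>
      \<bar>partial_deriv c (partial_deriv b \<gamma>) x\<bar> \<le> B b c"
    by metis
  \<comment> \<open>The summand 1 keeps \<open>K\<close> positive even if all second derivatives
    vanish.\<close>
  define K where "K = (\<Sum>b\<in>Basis. \<Sum>c\<in>(Basis::'a set). \<bar>B b c\<bar>) + 1"
  have "K > 0" unfolding K_def by (intro add_nonneg_pos sum_nonneg) auto
  have H: "\<bar>H h x\<bar> \<le> K * (norm h)\<^sup>2" if "x \<in> cball q 1" for h x
  proof -
    have "\<bar>H h x\<bar> \<le> (\<Sum>b\<in>Basis. \<bar>(h \<bullet> b) * (\<Sum>c\<in>Basis. (h \<bullet> c) * partial_deriv c (partial_deriv b \<gamma>) x)\<bar>)"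
      unfolding H_def by (rule sum_abs)
    also have "\<dots> \<le> (\<Sum>b\<in>Basis. norm h * (\<Sum>c\<in>Basis. norm h * \<bar>B b c\<bar>))"
    proof (rule sum_mono)
      fix b :: 'a assume b: "b \<in> Basis"
      have "\<bar>\<Sum>c\<in>Basis. (h \<bullet> c) * partial_deriv c (partial_deriv b \<gamma>) x\<bar>
          \<le> (\<Sum>c\<in>Basis. \<bar>(h \<bullet> c) * partial_deriv c (partial_deriv b \<gamma>) x\<bar>)"
        by (rule sum_abs)
      also have "\<dots> \<le> (\<Sum>c\<in>Basis. norm h * \<bar>B b c\<bar>)"
        using B[OF b _ that] unfolding abs_mult
        by (intro sum_mono mult_mono) (auto simp: Basis_le_norm intro: order_trans[OF _ abs_ge_self])
      finally show "\<bar>(h \<bullet> b) * (\<Sum>c\<in>Basis. (h \<bullet> c) * partial_deriv c (partial_deriv b \<gamma>) x)\<bar>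
          \<le> norm h * (\<Sum>c\<in>Basis. norm h * \<bar>B b c\<bar>)"
        unfolding abs_mult by (intro mult_mono) (auto simp: Basis_le_norm b)
    qed
    also have "\<dots> = (K - 1) * (norm h)\<^sup>2"
      by (simp add: K_def sum_distrib_left sum_distrib_right power2_eq_square mult_ac)
    also have "\<dots> \<le> K * (norm h)\<^sup>2" by (simp add: mult_right_mono)
    finally show ?thesis .
  qed
  have "\<bar>\<gamma> (q + h) - \<gamma> q - frechet_derivative \<gamma> (at q) h\<bar> \<le> K * (norm h)\<^sup>2" if h: "norm h \<le> 1" for h
  proof -
    define g where "g = (\<lambda>s. \<gamma> (q + s *\<^sub>R h))"
    define g' where "g' = (\<lambda>s. \<Sum>b\<in>Basis. (h \<bullet> b) * partial_deriv b \<gamma> (q + s *\<^sub>R h))"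
    have g': "(g has_real_derivative g' s) (at s)" for s
      using has_real_derivative_along_line[OF dif, where x = q and s = s and h = h]
      unfolding g_def g'_def frechet_derivative_eq_sum_partial_deriv[OF dif] .
    have g'': "(g' has_real_derivative H h (q + s *\<^sub>R h)) (at s)" for s
      unfolding g'_def H_def
      by (intro DERIV_sum DERIV_cmult)
        (use has_real_derivative_along_line[OF dif2, where x = q and s = s and h = h]
          frechet_derivative_eq_sum_partial_deriv[OF dif2] in simp)
    obtain z where z: "0 < z" "z < 1" "g 1 - g 0 = (1 - 0) * g' z"
      using MVT2[of 0 1 g g'] g' by force
    obtain y where y: "0 < y" "y < z" "g' z - g' 0 = (z - 0) * H h (q + y *\<^sub>R h)"
      using MVT2[of 0 z g' "\<lambda>s. H h (q + s *\<^sub>R h)"] g'' z by force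
    have eq: "\<gamma> (q + h) - \<gamma> q - frechet_derivative \<gamma> (at q) h = z * H h (q + y *\<^sub>R h)"
      using z y unfolding frechet_derivative_eq_sum_partial_deriv[OF dif]
      by (simp add: g_def g'_def)
    have "norm (y *\<^sub>R h) \<le> 1" using y z h by (simp add: mult_le_one)
    then have "q + y *\<^sub>R h \<in> cball q 1" by (simp add: dist_norm)
    then have "z * \<bar>H h (q + y *\<^sub>R h)\<bar> \<le> 1 * (K * (norm h)\<^sup>2)"
      using z by (intro mult_mono H) auto
    then show ?thesis unfolding eq abs_mult using z by simp
  qed
  with \<open>K > 0\<close> show ?thesis by blast
qed

section \<open>The Hopf boundary point lemma\<close>

text \<open>\<open>D\<close> and \<open>E\<close> are the unmixed first and second partial derivatives of \<open>v\<close>, given separately so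
  that no full second-order differentiability of \<open>v\<close> has to be established. The barrier is
  \<open>exp (- \<alpha> |x - y|\<^sup>2) - exp (- \<alpha> R\<^sup>2)\<close> on the annulus \<open>R/2 \<le> |x - y| \<le> R\<close>, with \<open>\<alpha>\<close> large enough to
  make it strictly subharmonic there.\<close>

lemma hopf_boundary_point:
  fixes v :: "'a::euclidean_space \<Rightarrow> real"
  assumes "R > 0" and x0: "dist y x0 = R"
    and cont: "continuous_on (cball y R) v"
    and D: "\<And>x b. x \<in> ball y R \<Longrightarrow> b \<in> Basis \<Longrightarrow> ((\<lambda>s. v (x + s *\<^sub>R b)) has_real_derivative D b x) (at 0)"
    and E: "\<And>x b. x \<in> ball y R \<Longrightarrow> b \<in> Basis \<Longrightarrow> ((\<lambda>s. D b (x + s *\<^sub>R b)) has_real_derivative E b x) (at 0)"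
    and subharmonic: "\<And>x. x \<in> ball y R \<Longrightarrow> (\<Sum>b\<in>Basis. E b x) \<ge> 0"
    and less: "\<And>x. x \<in> ball y R \<Longrightarrow> v x < M"
    and le: "\<And>x. x \<in> cball y R \<Longrightarrow> v x \<le> M"
  shows "\<exists>c>0. \<forall>t. 0 < t \<and> t < 1/2 \<longrightarrow> v (x0 + t *\<^sub>R (y - x0)) \<le> M - c * t"
proof -
  \<comment> \<open>The Laplacian of the exponential is
    \<open>\<alpha> * (4 * \<alpha> * |x - y|^2 - 2 * N)\<close> times the exponential itself, with
    \<open>N\<close> the dimension. For \<open>|x - y| >= R/2\<close> the bracket is at least
    \<open>\<alpha> * R^2 - 2 * N\<close>, which this choice makes equal to 1.\<close>
  define \<alpha> where "\<alpha> = (2 * DIM('a) + 1) / R\<^sup>2"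
  have \<alpha>: "\<alpha> > 0" "\<alpha> * R\<^sup>2 = 2 * DIM('a) + 1"
    using \<open>R > 0\<close> by (auto simp: \<alpha>_def intro!: divide_pos_pos)
  define h where "h = (\<lambda>x. exp (- \<alpha> * ((x - y) \<bullet> (x - y))) - exp (- \<alpha> * R\<^sup>2))"
  have "compact (v ` cball y (R/2))"
    by (intro compact_continuous_image continuous_on_subset[OF cont]) (use \<open>R > 0\<close> in auto)
  then obtain w where w: "w \<in> cball y (R/2)" "\<And>x. x \<in> cball y (R/2) \<Longrightarrow> v x \<le> v w"
    using compact_attains_sup[of "v ` cball y (R/2)"] \<open>R > 0\<close> by fastforce
  \<comment> \<open>The gap between \<open>M\<close> and the maximum of \<open>v\<close> on the
    inner ball. As \<open>h\<close> is at most 1, adding \<open>\<epsilon> * h\<close> keeps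
    \<open>v\<close> below \<open>M\<close> on the inner sphere.\<close>
  define \<epsilon> where "\<epsilon> = M - v w"
  have "\<epsilon> > 0" using less[of w] w \<open>R > 0\<close> by (auto simp: \<epsilon>_def)
  define K where "K = cball y R - ball y (R/2)"
  have "x0 \<in> K" using x0 \<open>R > 0\<close> by (auto simp: K_def)
  define W where "W = (\<lambda>x. v x + \<epsilon> * h x)"
  have "continuous_on K W" unfolding W_def h_def
    by (intro continuous_intros continuous_on_subset[OF cont]) (auto simp: K_def)
  moreover have "compact K" unfolding K_def by (intro compact_diff) auto
  ultimately obtain z where z: "z \<in> K" "\<And>x. x \<in> K \<Longrightarrow> W x \<le> W z"
    using continuous_attains_sup[of K W] \<open>x0 \<in> K\<close> by blast
  have dist2: "(x - y) \<bullet> (x - y) = (dist y x)\<^sup>2" for x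
    by (simp add: power2_norm_eq_inner dist_norm norm_minus_commute)
  \<comment> \<open>On the inner sphere the choice of \<open>\<epsilon>\<close> gives the bound, and
    on the outer one \<open>h\<close> vanishes. A maximum strictly between them would make all
    unmixed second derivatives of \<open>W\<close> nonpositive, although their sum is
    positive.\<close>
  have "W z \<le> M"
  proof -
    consider "dist y z = R/2" | "dist y z = R" | "R/2 < dist y z" "dist y z < R"
      using z(1) by (force simp: K_def)
    then show ?thesis
    proof cases
      case 1
      then have "v z \<le> v w" using w by auto
      moreover have "h z \<le> 1"
      proof -
        have "exp (- \<alpha> * ((z - y) \<bullet> (z - y))) \<le> 1" using \<alpha> by simp
        moreover have "exp (- \<alpha> * R\<^sup>2) > 0" by simp
        ultimately show ?thesis unfolding h_def by linarith
      qed
      ultimately show ?thesis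
        using \<open>\<epsilon> > 0\<close> mult_left_mono[of "h z" 1 \<epsilon>] \<epsilon>_def unfolding W_def by linarith
    next
      case 2
      then have "h z = 0" by (simp add: h_def dist2)
      then show ?thesis using le[of z] 2 by (simp add: W_def)
    next
      case 3
      have "open (ball y R - cball y (R/2))" by auto
      moreover have "z \<in> ball y R - cball y (R/2)" using 3 by auto
      ultimately obtain \<delta> where \<delta>: "\<delta> > 0" "ball z \<delta> \<subseteq> ball y R - cball y (R/2)"
        by (meson openE)
      \<comment> \<open>\<open>F b\<close> is the second derivative at \<open>z\<close> of the
        exponential in direction \<open>b\<close>.\<close>
      define F where "F = (\<lambda>b. (4 * \<alpha>\<^sup>2 * ((z - y) \<bullet> b)\<^sup>2 - 2 * \<alpha>) * exp (- \<alpha> * ((z - y) \<bullet> (z - y))))"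
      have "E b z + \<epsilon> * F b \<le> 0" if b: "b \<in> Basis" for b
      proof -
        define q where "q = (\<lambda>s. - \<alpha> * ((z + s *\<^sub>R b - y) \<bullet> (z + s *\<^sub>R b - y)))"
        have q: "q = (\<lambda>s. - \<alpha> * ((z - y) \<bullet> (z - y) + 2 * s * ((z - y) \<bullet> b) + s\<^sup>2))"
          using b by (auto simp: q_def fun_eq_iff algebra_simps inner_commute power2_eq_square)
        define g where "g = (\<lambda>s. W (z + s *\<^sub>R b))"
        have g: "g = (\<lambda>s. v (z + s *\<^sub>R b) + \<epsilon> * (exp (q s) - exp (- \<alpha> * R\<^sup>2)))"
          by (simp add: g_def W_def h_def q_def)
        define g' where "g' = (\<lambda>s. D b (z + s *\<^sub>R b) + \<epsilon> * (- 2 * \<alpha> * ((z - y) \<bullet> b + s) * exp (q s)))"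
        have near: "z + s *\<^sub>R b \<in> ball z \<delta>" if "\<bar>s\<bar> < \<delta>" for s
          using that b by (simp add: dist_norm)
        show ?thesis
        proof (rule second_derivative_nonpos_at_local_max[of \<delta> g g'])
          show "g s \<le> g 0" if "\<bar>s\<bar> < \<delta>" for s
            using z(2)[of "z + s *\<^sub>R b"] near[OF that] \<delta> unfolding g_def K_def by fastforce
          show "(g has_real_derivative g' s) (at s)" if s: "\<bar>s\<bar> < \<delta>" for s
          proof -
            \<comment> \<open>The assumption on \<open>D\<close> concerns parameter 0 only; moving
              the base point to \<open>z + s *\<^sub>R b\<close> and shifting the parameter gives
              the derivative at \<open>s\<close>.\<close>
            have "z + s *\<^sub>R b \<in> ball y R" using near[OF s] \<delta> by blast
            from D[OF this b]
            have "((\<lambda>t. v (z + t *\<^sub>R b)) has_real_derivative D b (z + s *\<^sub>R b)) (at s)"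
              using DERIV_shift[of "\<lambda>t. v (z + t *\<^sub>R b)" "D b (z + s *\<^sub>R b)" 0 s]
              by (simp add: algebra_simps)
            moreover have "((\<lambda>t. exp (q t)) has_real_derivative - 2 * \<alpha> * ((z - y) \<bullet> b + s) * exp (q s)) (at s)"
              unfolding q by (auto intro!: derivative_eq_intros simp: algebra_simps)
            ultimately have "(g has_real_derivative D b (z + s *\<^sub>R b)
                + \<epsilon> * (- 2 * \<alpha> * ((z - y) \<bullet> b + s) * exp (q s) - 0)) (at s)"
              unfolding g by (intro DERIV_add DERIV_cmult DERIV_diff DERIV_const)
            then show ?thesis by (simp add: g'_def)
          qed
          have "((\<lambda>t. - 2 * \<alpha> * ((z - y) \<bullet> b + t) * exp (q t)) has_real_derivative F b) (at 0)"
            unfolding q F_def by (auto intro!: derivative_eq_intros simp: algebra_simps power2_eq_square)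
          moreover have "((\<lambda>s. D b (z + s *\<^sub>R b)) has_real_derivative E b z) (at 0)"
            using E b 3 by simp
          ultimately show "(g' has_real_derivative E b z + \<epsilon> * F b) (at 0)"
            unfolding g'_def by (intro DERIV_add DERIV_cmult)
        qed (use \<delta> in auto)
      qed
      then have "(\<Sum>b\<in>Basis. E b z + \<epsilon> * F b) \<le> 0" by (rule sum_nonpos)
      then have "(\<Sum>b\<in>Basis. E b z) + \<epsilon> * (\<Sum>b\<in>Basis. F b) \<le> 0"
        by (simp add: sum.distrib sum_distrib_left)
      moreover have "(\<Sum>b\<in>Basis. F b) > 0"
      proof -
        have "(\<Sum>b\<in>Basis. F b) = (4 * \<alpha>\<^sup>2 * (\<Sum>b\<in>Basis. ((z - y) \<bullet> b)\<^sup>2) - 2 * \<alpha> * DIM('a)) * exp (- \<alpha> * ((z - y) \<bullet> (z - y)))"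
          unfolding F_def sum_distrib_right[symmetric]
          by (simp add: sum_subtractf sum_distrib_left)
        also have "(\<Sum>b\<in>Basis. ((z - y) \<bullet> b)\<^sup>2) = (dist y z)\<^sup>2"
          unfolding dist2[symmetric] by (subst euclidean_inner) (simp add: power2_eq_square)
        finally have eq: "(\<Sum>b\<in>Basis. F b) = \<alpha> * (\<alpha> * (4 * (dist y z)\<^sup>2) - 2 * DIM('a)) * exp (- \<alpha> * ((z - y) \<bullet> (z - y)))"
          by (simp add: algebra_simps power2_eq_square)
        have "R\<^sup>2 \<le> 4 * (dist y z)\<^sup>2"
          using power_mono[of "R/2" "dist y z" 2] 3 \<open>R > 0\<close> by (simp add: power_divide)
        then have "\<alpha> * R\<^sup>2 \<le> \<alpha> * (4 * (dist y z)\<^sup>2)" using \<alpha>(1) by (intro mult_left_mono) auto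
        then have "\<alpha> * (4 * (dist y z)\<^sup>2) - 2 * DIM('a) > 0" using \<alpha> by simp
        then show ?thesis unfolding eq using \<alpha> by simp
      qed
      ultimately have False
        using subharmonic[of z] 3 mult_pos_pos[OF \<open>\<epsilon> > 0\<close>, of "\<Sum>b\<in>Basis. F b"] by auto
      then show ?thesis ..
    qed
  qed
  \<comment> \<open>At parameter \<open>t\<close> the distance to \<open>y\<close> is
    \<open>(1 - t) * R\<close>, so \<open>t < 1/2\<close> stays in the annulus. There
    \<open>h\<close> is bounded below linearly in \<open>t\<close>, by \<open>1 + s <= exp s\<close>
    and \<open>t <= 1 - (1 - t)^2\<close>; \<open>c\<close> is \<open>\<epsilon>\<close> times the
    resulting slope.\<close>
  define c where "c = \<epsilon> * (exp (- \<alpha> * R\<^sup>2) * (\<alpha> * R\<^sup>2))"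
  have "c > 0" unfolding c_def using \<open>\<epsilon> > 0\<close> \<alpha> by simp
  moreover have "v (x0 + t *\<^sub>R (y - x0)) \<le> M - c * t" if t: "0 < t" "t < 1/2" for t
  proof -
    let ?x = "x0 + t *\<^sub>R (y - x0)"
    have "y - ?x = (1 - t) *\<^sub>R (y - x0)" by (simp add: algebra_simps)
    then have d: "dist y ?x = (1 - t) * R"
      using t x0 by (simp only: dist_norm) simp
    have "?x \<in> K" unfolding K_def using d t \<open>R > 0\<close>
      by (auto simp: mult_left_le_one_le)
    then have le: "v ?x + \<epsilon> * h ?x \<le> M" using z(2) \<open>W z \<le> M\<close> unfolding W_def by force
    have "h ?x = exp (- \<alpha> * R\<^sup>2) * (exp (\<alpha> * R\<^sup>2 * (1 - (1 - t)\<^sup>2)) - 1)"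
      unfolding h_def dist2 d power_mult_distrib
      by (simp add: right_diff_distrib flip: exp_add)
    also have "\<dots> \<ge> exp (- \<alpha> * R\<^sup>2) * (\<alpha> * R\<^sup>2 * t)"
    proof (rule mult_left_mono)
      have "t \<le> 1 - (1 - t)\<^sup>2" using t by (simp add: power2_eq_square algebra_simps)
      then have "\<alpha> * R\<^sup>2 * t \<le> \<alpha> * R\<^sup>2 * (1 - (1 - t)\<^sup>2)"
        using \<alpha> by (intro mult_left_mono) auto
      also have "\<dots> \<le> exp (\<alpha> * R\<^sup>2 * (1 - (1 - t)\<^sup>2)) - 1"
        using exp_ge_add_one_self[of "\<alpha> * R\<^sup>2 * (1 - (1 - t)\<^sup>2)"] by linarith
      finally show "\<alpha> * R\<^sup>2 * t \<le> exp (\<alpha> * R\<^sup>2 * (1 - (1 - t)\<^sup>2)) - 1" .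
    qed simp
    finally have "\<epsilon> * (exp (- \<alpha> * R\<^sup>2) * (\<alpha> * R\<^sup>2 * t)) \<le> \<epsilon> * h ?x"
      using \<open>\<epsilon> > 0\<close> by (intro mult_left_mono) auto
    with le show ?thesis by (simp add: c_def mult_ac)
  qed
  ultimately show ?thesis by blast
qed

section \<open>The strong maximum principle\<close>

text \<open>The set where \<open>v\<close> equals \<open>M\<close> is closed in \<open>S\<close>. If
  it were not open, some ball free of such points would have one of them, \<open>x0\<close>, on its
  boundary. Hopf's lemma then forces a linear decrease into the ball, against the vanishing
  derivative at the interior maximum \<open>x0\<close>. Connectedness does the rest.\<close>

lemma subharmonic_strong_maximum:
  fixes v :: "'a::euclidean_space \<Rightarrow> real"
  assumes "open S" "connected S"
    and dif: "\<And>x. x \<in> S \<Longrightarrow> v differentiable (at x)"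
    and D: "\<And>x b. x \<in> S \<Longrightarrow> b \<in> Basis \<Longrightarrow> ((\<lambda>s. v (x + s *\<^sub>R b)) has_real_derivative D b x) (at 0)"
    and E: "\<And>x b. x \<in> S \<Longrightarrow> b \<in> Basis \<Longrightarrow> ((\<lambda>s. D b (x + s *\<^sub>R b)) has_real_derivative E b x) (at 0)"
    and subharmonic: "\<And>x. x \<in> S \<Longrightarrow> (\<Sum>b\<in>Basis. E b x) \<ge> 0"
    and le: "\<And>x. x \<in> S \<Longrightarrow> v x \<le> M"
    and z: "z \<in> S" "v z = M" and x: "x \<in> S"
  shows "v x = M"
proof -
  have cont: "continuous_on S v"
    using dif by (meson continuous_at_imp_continuous_on differentiable_imp_continuous_within)
  define A where "A = {x\<in>S. v x = M}"
  have "closedin (top_of_set S) A"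
    unfolding A_def using cont by (rule continuous_closedin_preimage_constant)
  moreover have "openin (top_of_set S) A"
  proof -
    have "\<exists>r>0. ball a r \<subseteq> A" if aA: "a \<in> A" for a
    proof -
      have aS: "a \<in> S" "v a = M" using aA by (auto simp: A_def)
      \<comment> \<open>The factor 2 leaves room: for \<open>y\<close> in \<open>ball a r\<close>, a
        ball about \<open>y\<close> of radius at most \<open>dist y a\<close> stays inside
        \<open>ball a (2 * r)\<close>.\<close>
      obtain r where r: "r > 0" "cball a (2 * r) \<subseteq> S"
      proof -
        obtain r where "r > 0" "cball a r \<subseteq> S"
          using \<open>open S\<close> aS(1) open_contains_cball by blast
        then show ?thesis by (intro that[of "r/2"]) auto
      qed
      have "ball a r \<subseteq> A"
      proof
        fix y assume y: "y \<in> ball a r"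
        \<comment> \<open>Cutting the contact set down to a closed ball makes it compact, so a point
          \<open>x0\<close> nearest to \<open>y\<close> exists.\<close>
        let ?T = "{x\<in>cball a (2 * r). v x = M}"
        have "closed ?T"
          using continuous_closed_preimage_constant[of "cball a (2 * r)" v M] continuous_on_subset[OF cont r(2)]
          by auto
        moreover have "bounded ?T" by (rule bounded_subset[OF bounded_cball]) auto
        ultimately have "compact ?T" by (simp add: compact_eq_bounded_closed)
        moreover have a: "a \<in> ?T" using aS r by simp
        ultimately obtain x0 where x0: "x0 \<in> ?T" "\<And>x. x \<in> ?T \<Longrightarrow> dist y x0 \<le> dist y x"
          using distance_attains_inf[of ?T y] compact_imp_closed by blast
        define R where "R = dist y x0"
        have "R \<le> dist y a" using x0(2)[OF a] by (simp add: R_def)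
        then have sub: "cball y R \<subseteq> ball a (2 * r)"
          using y by (auto simp: cball_subset_ball_iff dist_commute)
        then have subS: "cball y R \<subseteq> S" using r by force
        have "R = 0"
        proof (rule ccontr)
          assume "R \<noteq> 0"
          then have "R > 0" by (simp add: R_def)
          have bS: "x \<in> S" if "x \<in> ball y R" for x using that subS by auto
          have "\<exists>c>0. \<forall>t. 0 < t \<and> t < 1/2 \<longrightarrow> v (x0 + t *\<^sub>R (y - x0)) \<le> M - c * t"
          proof (rule hopf_boundary_point[where D = D and E = E])
            show "v x < M" if "x \<in> ball y R" for x
            proof -
              have "x \<notin> ?T" using x0(2)[of x] that by (auto simp: R_def)
              moreover have "x \<in> cball a (2 * r)"
                using order_trans[OF ball_subset_cball order_trans[OF sub ball_subset_cball]] that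
                by (rule subsetD)
              ultimately show ?thesis using le[OF bS[OF that]] by auto
            qed
          qed (use \<open>R > 0\<close> D E subharmonic bS le subS in \<open>auto simp: R_def intro: continuous_on_subset[OF cont]\<close>)
          then obtain c where c: "c > 0"
            "\<And>t. 0 < t \<Longrightarrow> t < 1/2 \<Longrightarrow> v (x0 + t *\<^sub>R (y - x0)) \<le> M - c * t" by blast
          have "x0 \<in> S" using x0 r by auto
          then obtain e where e: "e > 0" "cball x0 e \<subseteq> S"
            using \<open>open S\<close> open_contains_cball by blast
          define d where "d = frechet_derivative v (at x0) (y - x0)"
          define g where "g = (\<lambda>t. v (x0 + t *\<^sub>R (y - x0)))"
          have d: "(g has_real_derivative d) (at 0)"
            using has_real_derivative_along_line[of v x0 0 "y - x0"] dif[OF \<open>x0 \<in> S\<close>]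
            by (simp add: d_def g_def)
          have g0: "g 0 = M" using x0 by (simp add: g_def)
          have "d = 0"
          proof (rule DERIV_local_max[OF d])
            show "e / R > 0" using e \<open>R > 0\<close> by simp
            show "\<forall>t. \<bar>0 - t\<bar> < e / R \<longrightarrow> g t \<le> g 0"
            proof (intro allI impI)
              fix t assume "\<bar>0 - t\<bar> < e / R"
              then have "\<bar>t\<bar> * R \<le> e" using \<open>R > 0\<close> by (simp add: field_simps)
              then have "x0 + t *\<^sub>R (y - x0) \<in> cball x0 e"
                by (simp add: dist_norm R_def)
              then show "g t \<le> g 0" using le e g0 by (auto simp: g_def)
            qed
          qed
          \<comment> \<open>Since \<open>d = 0\<close>, this sum has slope \<open>c > 0\<close> and
            exceeds \<open>M\<close> just to the right of 0, whereas Hopf's bound keeps it at most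
            \<open>M\<close>.\<close>
          have "((\<lambda>t. g t + c * t) has_real_derivative d + c) (at 0)"
            by (auto intro!: derivative_eq_intros d)
          then obtain \<delta> where \<delta>: "\<delta> > 0" "\<And>h. 0 < h \<Longrightarrow> h < \<delta> \<Longrightarrow> g 0 < g h + c * h"
            using DERIV_pos_inc_right[of "\<lambda>t. g t + c * t" "d + c" 0] c \<open>d = 0\<close> by auto
          define h where "h = min \<delta> (1/2) / 2"
          have "0 < h" "h < \<delta>" "h < 1/2" using \<delta> by (auto simp: h_def)
          then show False using \<delta>(2)[of h] c(2)[of h] g0 by (simp add: g_def)
        qed
        then have "y = x0" by (simp add: R_def)
        then show "y \<in> A" using x0 r by (auto simp: A_def)
      qed
      with r show ?thesis by blast
    qed
    then have "open A" by (simp add: open_contains_ball)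
    then show ?thesis by (rule open_subset[rotated]) (auto simp: A_def)
  qed
  moreover have "A \<noteq> {}" using z by (auto simp: A_def)
  ultimately have "A = S" using \<open>connected S\<close> unfolding connected_clopen by blast
  with x show ?thesis by (auto simp: A_def)
qed

section \<open>The outward normal and interior balls\<close>

text \<open>The definite description behind \<open>outward_unit_normal\<close> is usable only after
  existence and uniqueness. Writing the frontier locally as a zero set of \<open>\<phi>\<close> with
  gradient \<open>a\<close> at \<open>p\<close>, the tangent vectors are exactly those orthogonal to
  \<open>a\<close>, which leaves two unit normals, and only the one opposite to \<open>a\<close>
  leaves \<open>S\<close>. The quadratic Taylor error yields the ball.\<close>

lemma C2_boundary_interior_ball:
  fixes S :: "'a::euclidean_space set"
  assumes "open S" and C2: "Ck_boundary 2 S" and p: "p \<in> frontier S"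
  shows "norm (outward_unit_normal S p) = 1 \<and>
    (\<exists>R>0. ball (p - R *\<^sub>R outward_unit_normal S p) R \<subseteq> S)"
proof -
  obtain r e \<gamma> where "r > 0" "norm e = 1" and \<gamma>: "Ck_on 2 UNIV \<gamma>"
    and S: "S \<inter> ball p r = {x \<in> ball p r. \<gamma> (x - (x \<bullet> e) *\<^sub>R e) < x \<bullet> e}"
    using C2 p unfolding Ck_boundary_def by blast
  have ee: "e \<bullet> e = 1" using \<open>norm e = 1\<close> by (simp add: norm_eq_1)
  have dif: "\<gamma> differentiable (at x)" for x
    using \<gamma> by (simp add: numeral_2_eq_2)
  have dif2: "partial_deriv b \<gamma> differentiable (at x)" if "b \<in> Basis" for b x
    using \<gamma> that by (simp add: numeral_2_eq_2)
  have cont\<gamma>: "continuous_on A \<gamma>" for A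
    using dif by (meson continuous_at_imp_continuous_on differentiable_imp_continuous_within)
  have cont\<gamma>': "continuous_on A (partial_deriv b \<gamma>)" if "b \<in> Basis" for A b
    using dif2[OF that] by (meson continuous_at_imp_continuous_on differentiable_imp_continuous_within)
  \<comment> \<open>Orthogonal projection to the hyperplane in which the graph coordinates
    live.\<close>
  define P where "P = (\<lambda>x. x - (x \<bullet> e) *\<^sub>R e)"
  have P: "linear P" unfolding P_def
    by (rule linearI) (auto simp: algebra_simps)
  have Pe: "P e = 0" by (simp add: P_def ee)
  have PP: "P (P x) = P x" for x by (simp add: P_def algebra_simps ee)
  have Pn: "norm (P x) \<le> norm x" for x
  proof -
    have "P x \<bullet> P x = x \<bullet> x - (x \<bullet> e)\<^sup>2"
      by (simp add: P_def algebra_simps ee inner_commute power2_eq_square)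
    then show ?thesis by (simp add: norm_le)
  qed
  \<comment> \<open>Height above the graph along \<open>e\<close>: near \<open>p\<close> its sign
    separates \<open>S\<close>, the frontier and the exterior.\<close>
  define \<phi> where "\<phi> = (\<lambda>x. x \<bullet> e - \<gamma> (P x))"
  have S: "x \<in> S \<longleftrightarrow> \<phi> x > 0" if "x \<in> ball p r" for x
  proof -
    have "x \<in> S \<longleftrightarrow> x \<in> S \<inter> ball p r" using that by simp
    also have "\<dots> \<longleftrightarrow> \<phi> x > 0" using that unfolding S \<phi>_def P_def by simp
    finally show ?thesis .
  qed
  have cont\<phi>: "continuous_on A \<phi>" for A
    unfolding \<phi>_def P_def by (intro continuous_intros continuous_on_compose2[OF cont\<gamma>]) auto
  have out: "x \<notin> closure S" if "x \<in> ball p r" "\<phi> x < 0" for x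
  proof -
    let ?U = "{x \<in> ball p r. \<phi> x < 0}"
    have "open ?U"
      using continuous_open_preimage[OF cont\<phi>[of "ball p r"], of "{..<0}"]
      by (simp add: vimage_def Int_def)
    moreover have "?U \<inter> S = {}" using S by force
    ultimately have "?U \<inter> closure S = {}" by (simp add: open_Int_closure_eq_empty)
    with that show ?thesis by auto
  qed
  have frontier: "x \<in> frontier S \<longleftrightarrow> \<phi> x = 0" if x: "x \<in> ball p r" for x
  proof
    assume "x \<in> frontier S"
    then have "x \<notin> S" "x \<in> closure S"
      using \<open>open S\<close> by (auto simp: frontier_def interior_open)
    then show "\<phi> x = 0" using S[OF x] out[OF x] by force
  next
    assume 0: "\<phi> x = 0"
    have "x \<in> closure S"
      unfolding closure_approachable
    proof (intro allI impI)
      fix \<epsilon> :: real assume "\<epsilon> > 0"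
      \<comment> \<open>A shift by \<open>t\<close> along \<open>e\<close> leaves the projection
        unchanged and raises \<open>\<phi>\<close> by exactly \<open>t\<close>, so it enters
        \<open>S\<close>; the bounds on \<open>t\<close> keep it close to \<open>x\<close> and
        inside \<open>ball p r\<close>.\<close>
      define t where "t = min \<epsilon> (r - dist p x) / 2"
      have t: "t > 0" "t < \<epsilon>" "t < r - dist p x"
        using x \<open>\<epsilon> > 0\<close> by (auto simp: t_def)
      have d: "dist (x + t *\<^sub>R e) x = t" using t \<open>norm e = 1\<close> by (simp add: dist_norm)
      then have "x + t *\<^sub>R e \<in> ball p r"
        using t dist_triangle[of p "x + t *\<^sub>R e" x] by (simp add: dist_commute)
      moreover have "\<phi> (x + t *\<^sub>R e) = t" using 0
        by (simp add: \<phi>_def linear_add[OF P] linear_cmul[OF P] Pe inner_add_left ee)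
      ultimately show "\<exists>y\<in>S. dist y x < \<epsilon>" using S t d by (intro bexI[of _ "x + t *\<^sub>R e"]) auto
    qed
    moreover have "x \<notin> S" using S[OF x] 0 by simp
    ultimately show "x \<in> frontier S" using \<open>open S\<close> by (simp add: frontier_def interior_open)
  qed
  have \<phi>p: "\<phi> p = 0" using frontier[of p] p \<open>r > 0\<close> by simp
  define d where "d = frechet_derivative \<gamma> (at (P p))"
  have d: "(\<gamma> has_derivative d) (at (P p))"
    unfolding d_def using dif frechet_derivative_works by blast
  define l where "l = (\<lambda>h. h \<bullet> e - d (P h))"
  have lin: "linear l" unfolding l_def
    using linear_compose[OF P has_derivative_linear[OF d]]
    by (intro linear_compose_sub) (auto simp: o_def intro!: bounded_linear.linear bounded_linear_inner_left)
  \<comment> \<open>\<open>a\<close> is the gradient of \<open>\<phi>\<close> at \<open>p\<close>.\<close>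
  define a where "a = (\<Sum>b\<in>Basis. l b *\<^sub>R b)"
  have a: "h \<bullet> a = h \<bullet> e - d (P h)" for h
  proof -
    have "l h = l (\<Sum>b\<in>Basis. (h \<bullet> b) *\<^sub>R b)"
      by (simp add: euclidean_representation)
    also have "\<dots> = (\<Sum>b\<in>Basis. (h \<bullet> b) * l b)"
      by (simp add: linear_sum[OF lin] linear_cmul[OF lin])
    also have "\<dots> = h \<bullet> a" by (simp add: a_def inner_sum_right mult.commute)
    finally show ?thesis by (simp add: l_def)
  qed
  \<comment> \<open>The derivative of \<open>\<phi>\<close> along \<open>e\<close> is 1, because
    \<open>P e = 0\<close>.\<close>
  have "a \<noteq> 0" using a[of e] has_derivative_linear[OF d] by (auto simp: ee Pe linear_0)
  define m where "m = a /\<^sub>R norm a"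
  have m: "norm m = 1" "a = norm a *\<^sub>R m" using \<open>a \<noteq> 0\<close> by (auto simp: m_def)
  have mm: "m \<bullet> m = 1" using m by (simp add: norm_eq_1)
  have ma: "h \<bullet> a = norm a * (h \<bullet> m)" for h by (metis inner_scaleR_right m(2))
  obtain K where "K > 0" and K: "\<And>h. norm h \<le> 1 \<Longrightarrow>
      \<bar>\<gamma> (P p + h) - \<gamma> (P p) - d h\<bar> \<le> K * (norm h)\<^sup>2"
    using second_order_remainder_bound[OF \<gamma>, of "P p"] unfolding d_def by blast
  have taylor: "\<bar>\<phi> (p + h) - h \<bullet> a\<bar> \<le> K * (norm h)\<^sup>2" if "norm h \<le> 1" for h
  proof -
    have "\<phi> (p + h) - h \<bullet> a = - (\<gamma> (P p + P h) - \<gamma> (P p) - d (P h))"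
      using \<phi>p by (simp add: \<phi>_def a linear_add[OF P] inner_add_left)
    moreover have "\<bar>\<gamma> (P p + P h) - \<gamma> (P p) - d (P h)\<bar> \<le> K * (norm (P h))\<^sup>2"
      using K[of "P h"] Pn[of h] that by simp
    moreover have "K * (norm (P h))\<^sup>2 \<le> K * (norm h)\<^sup>2"
      using \<open>K > 0\<close> Pn by (intro mult_left_mono power_mono) auto
    ultimately show ?thesis by linarith
  qed

  \<comment> \<open>\<open>\<phi>\<close> vanishes along any curve in the frontier near
    \<open>p\<close>, so the chain rule kills its derivative \<open>v \<bullet> a\<close>.\<close>
  have tan1: "v \<bullet> a = 0" if v: "v \<in> tangent_vectors (frontier S) p" for v
  proof -
    from v obtain c \<epsilon> where c: "\<epsilon> > 0" "c C1_differentiable_on {-\<epsilon><..<\<epsilon>}"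
        "c ` {-\<epsilon><..<\<epsilon>} \<subseteq> frontier S" "c 0 = p" "(c has_vector_derivative v) (at 0)"
      unfolding tangent_vectors_def by blast
    have "(P has_derivative P) (at p)"
      by (rule linear_imp_has_derivative[OF P])
    from diff_chain_at[OF this d] have "((\<lambda>x. \<gamma> (P x)) has_derivative (\<lambda>h. d (P h))) (at p)"
      by (simp add: o_def)
    then have "(\<phi> has_derivative (\<lambda>h. h \<bullet> a)) (at (c 0))"
      unfolding \<phi>_def a c(4) by (intro has_derivative_diff has_derivative_inner_left has_derivative_ident)
    from diff_chain_at[OF c(5)[unfolded has_vector_derivative_def] this]
    have D: "((\<lambda>t. \<phi> (c t)) has_real_derivative (v \<bullet> a)) (at 0)"
      by (simp add: o_def has_field_derivative_def mult.commute[of "v \<bullet> a"])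
        (simp add: mult_commute_abs)
    have "isCont c 0" using c(5) has_vector_derivative_continuous by blast
    then obtain s where s: "s > 0" "\<And>t. \<bar>t\<bar> < s \<Longrightarrow> dist (c t) p < r"
      using \<open>r > 0\<close> unfolding continuous_at_eps_delta c(4) by (auto simp: dist_real_def)
    show ?thesis
    proof (rule DERIV_local_const[OF D])
      show "min s \<epsilon> > 0" using s c by simp
      show "\<forall>t. \<bar>0 - t\<bar> < min s \<epsilon> \<longrightarrow> \<phi> (c 0) = \<phi> (c t)"
      proof (intro allI impI)
        fix t assume t: "\<bar>0 - t\<bar> < min s \<epsilon>"
        then have "t \<in> {-\<epsilon><..<\<epsilon>}" by (auto simp: abs_less_iff)
        then have "c t \<in> frontier S" using c(3) by blast
        moreover have "c t \<in> ball p r" using s(2)[of t] t by (simp add: dist_commute)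
        ultimately show "\<phi> (c 0) = \<phi> (c t)" using frontier \<phi>p c(4) by simp
      qed
    qed
  qed
  \<comment> \<open>The curve is obtained by lifting a line in the hyperplane to the graph of \<open>\<gamma>\<close>.\<close>
  have tan2: "v \<in> tangent_vectors (frontier S) p" if v: "v \<bullet> a = 0" for v
  proof -
    define w where "w = P v"
    have "v = w + (v \<bullet> e) *\<^sub>R e" by (simp add: w_def P_def)
    also have "v \<bullet> e = d w" using v by (simp add: a w_def)
    finally have vw: "v = w + d w *\<^sub>R e" .
    define c where "c = (\<lambda>t. p + t *\<^sub>R w + (\<gamma> (P p + t *\<^sub>R w) - \<gamma> (P p)) *\<^sub>R e)"
    define c' where "c' = (\<lambda>t. w + frechet_derivative \<gamma> (at (P p + t *\<^sub>R w)) w *\<^sub>R e)"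
    have c': "(c has_vector_derivative c' t) (at t)" for t
    proof -
      have "((\<lambda>t. \<gamma> (P p + t *\<^sub>R w)) has_vector_derivative frechet_derivative \<gamma> (at (P p + t *\<^sub>R w)) w) (at t)"
        using has_real_derivative_along_line[OF dif]
        by (simp add: has_real_derivative_iff_has_vector_derivative)
      then show ?thesis unfolding c_def c'_def
        by (auto intro!: derivative_eq_intros simp: has_real_derivative_iff_has_vector_derivative)
    qed
    have contc': "continuous_on A c'" for A
      unfolding c'_def frechet_derivative_eq_sum_partial_deriv[OF dif]
      by (intro continuous_intros continuous_on_compose2[OF cont\<gamma>']) auto
    have "isCont c 0" using c' has_vector_derivative_continuous by blast
    moreover have c0: "c 0 = p" by (simp add: c_def)
    ultimately obtain s where s: "s > 0" "\<And>t. \<bar>t\<bar> < s \<Longrightarrow> dist (c t) p < r"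
      using \<open>r > 0\<close> unfolding continuous_at_eps_delta by (auto simp: dist_real_def)
    have "c ` {-s<..<s} \<subseteq> frontier S"
    proof clarify
      fix t assume "t \<in> {-s<..<s}"
      then have "c t \<in> ball p r" using s(2)[of t] by (simp add: dist_commute abs_less_iff)
      moreover have "\<phi> (c t) = 0"
      proof -
        have "P (c t) = P p + t *\<^sub>R w"
          by (simp add: c_def linear_add[OF P] linear_cmul[OF P] Pe w_def PP)
        moreover have "w \<bullet> e = 0" by (simp add: w_def P_def inner_diff_left ee)
        then have "c t \<bullet> e = p \<bullet> e + (\<gamma> (P p + t *\<^sub>R w) - \<gamma> (P p))"
          by (simp add: c_def inner_add_left ee)
        ultimately show ?thesis using \<phi>p by (simp add: \<phi>_def)
      qed
      ultimately show "c t \<in> frontier S" using frontier by simp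
    qed
    moreover have "c C1_differentiable_on {-s<..<s}"
      unfolding C1_differentiable_on_def using c' contc' by blast
    moreover have "(c has_vector_derivative v) (at 0)"
      using c'[of 0] by (simp add: c'_def vw d_def)
    ultimately show ?thesis unfolding tangent_vectors_def using s(1) c0 by blast
  qed

  \<comment> \<open>Below \<open>norm a / K\<close> the linear term \<open>t * norm a\<close> beats
    the error \<open>K * t^2\<close>; the other two bounds keep the points in
    \<open>ball p r\<close> and within the range of \<open>taylor\<close>.\<close>
  define \<delta>0 where "\<delta>0 = min (min r 1) (norm a / K)"
  have "\<delta>0 > 0" using \<open>r > 0\<close> \<open>K > 0\<close> \<open>a \<noteq> 0\<close> by (simp add: \<delta>0_def)
  have small: "K * t\<^sup>2 < t * norm a" "p + t *\<^sub>R m \<in> ball p r" "p - t *\<^sub>R m \<in> ball p r" "t \<le> 1"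
    if "0 < t" "t < \<delta>0" for t
    using that \<open>K > 0\<close> m(1) by (auto simp: \<delta>0_def power2_eq_square field_simps dist_norm)
  have mam: "m \<bullet> a = norm a" using ma[of m] mm by simp
  have inside: "p + t *\<^sub>R m \<in> S" if t: "0 < t" "t < \<delta>0" for t
    using taylor[of "t *\<^sub>R m"] small[OF t] t m(1) mam S by (auto simp: abs_le_iff)
  have outside: "p - t *\<^sub>R m \<notin> closure S" if t: "0 < t" "t < \<delta>0" for t
    using taylor[of "- t *\<^sub>R m"] small[OF t] t m(1) mam by (intro out) (auto simp: abs_le_iff)
  have normal: "outward_unit_normal S p = - m"
    unfolding outward_unit_normal_def
  proof (rule the_equality)
    show "is_outward_unit_normal S p (- m)"
      unfolding is_outward_unit_normal_def
    proof (intro conjI ballI exI[of _ \<delta>0])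
      fix v assume "v \<in> tangent_vectors (frontier S) p"
      then have "v \<bullet> a = 0" by (rule tan1)
      then show "- m \<bullet> v = 0" using ma[of v] \<open>a \<noteq> 0\<close> by (simp add: inner_commute)
    qed (use m outside \<open>\<delta>0 > 0\<close> in auto)
  next
    fix n assume n: "is_outward_unit_normal S p n"
    then obtain \<delta> where \<delta>: "\<delta> > 0" "\<And>t. 0 < t \<Longrightarrow> t < \<delta> \<Longrightarrow> p + t *\<^sub>R n \<notin> closure S"
      and "norm n = 1" and perp: "\<And>v. v \<in> tangent_vectors (frontier S) p \<Longrightarrow> n \<bullet> v = 0"
      unfolding is_outward_unit_normal_def by blast
    \<comment> \<open>The part of \<open>n\<close> orthogonal to \<open>m\<close> is tangent by
      \<open>tan2\<close>, hence orthogonal to \<open>n\<close> and so zero. Thus \<open>n\<close>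
      is \<open>m\<close> or \<open>- m\<close>, and \<open>m\<close> points into
      \<open>S\<close>.\<close>
    define v where "v = n - (n \<bullet> m) *\<^sub>R m"
    have vm: "v \<bullet> m = 0" by (simp add: v_def inner_diff_left mm)
    then have "n \<bullet> v = 0" using ma by (intro perp tan2) simp
    then have "v \<bullet> v = 0" using vm by (simp add: v_def inner_diff_left inner_commute)
    then have nm: "n = (n \<bullet> m) *\<^sub>R m" by (simp add: v_def)
    then have "\<bar>n \<bullet> m\<bar> = 1" using \<open>norm n = 1\<close> m(1) by (metis norm_scaleR mult.right_neutral)
    moreover have "n \<bullet> m \<noteq> 1"
    proof
      assume "n \<bullet> m = 1"
      then have "n = m" using nm by simp
      define t where "t = min \<delta> \<delta>0 / 2"
      have "0 < t" "t < \<delta>" "t < \<delta>0" using \<delta> \<open>\<delta>0 > 0\<close> by (auto simp: t_def)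
      then show False using inside[of t] \<delta>(2)[of t] \<open>n = m\<close> closure_subset by blast
    qed
    ultimately have "n \<bullet> m = - 1" by linarith
    then show "n = - m" using nm by simp
  qed
  \<comment> \<open>Points \<open>p + h\<close> of the ball satisfy \<open>norm h < 2 * R\<close>
    and \<open>|h|^2 < 2 * R * (h \<bullet> m)\<close>. With \<open>2 * R * K <= norm a\<close> the
    Taylor error is then smaller than \<open>h \<bullet> a\<close>, so \<open>\<phi>\<close> is
    positive.\<close>
  define R where "R = min (min r 1 / 2) (norm a / (2 * K))"
  have R: "R > 0" "2 * R \<le> r" "2 * R \<le> 1"
    using \<open>r > 0\<close> \<open>K > 0\<close> \<open>a \<noteq> 0\<close> by (auto simp: R_def)
  have RK: "2 * R * K \<le> norm a"
  proof -
    have "R \<le> norm a / (2 * K)" by (simp add: R_def)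
    then show ?thesis using \<open>K > 0\<close> by (simp add: field_simps)
  qed
  have "ball (p + R *\<^sub>R m) R \<subseteq> S"
  proof
    fix x assume x: "x \<in> ball (p + R *\<^sub>R m) R"
    define h where "h = x - p"
    have lt: "norm (h - R *\<^sub>R m) < R"
      using x by (simp add: h_def dist_norm norm_minus_commute algebra_simps)
    have "norm h \<le> norm (h - R *\<^sub>R m) + norm (R *\<^sub>R m)" by (metis diff_add_cancel norm_triangle_ineq)
    then have h: "norm h < 2 * R" using lt m(1) R by simp
    have "(norm (h - R *\<^sub>R m))\<^sup>2 < R\<^sup>2" using lt by (intro power_strict_mono) auto
    then have hm: "h \<bullet> h < 2 * R * (h \<bullet> m)"
      unfolding power2_norm_eq_inner by (simp add: algebra_simps inner_commute mm power2_eq_square)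
    then have "h \<bullet> m > 0" using R inner_ge_zero[of h] by (smt (verit) mult_nonneg_nonpos)
    have "K * (h \<bullet> h) < K * (2 * R * (h \<bullet> m))" using hm \<open>K > 0\<close> by simp
    also have "\<dots> \<le> norm a * (h \<bullet> m)"
      using mult_right_mono[OF RK, of "h \<bullet> m"] \<open>h \<bullet> m > 0\<close> by (simp add: mult_ac)
    finally have "K * (norm h)\<^sup>2 < h \<bullet> a" by (simp add: ma power2_norm_eq_inner)
    then have "\<phi> (p + h) > 0" using taylor[of h] h R by (simp add: abs_le_iff)
    moreover have "p + h \<in> ball p r" using h R by (simp add: dist_norm)
    ultimately have "p + h \<in> S" using S by simp
    then show "x \<in> S" by (simp add: h_def)
  qed
  with R normal m(1) show ?thesis by auto
qed

section \<open>Rigidity for the Neumann problem\<close>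

theorem theorem1p2:
  fixes \<Omega> :: "(real ^ 'n) set"
    and f :: "real \<Rightarrow> real"
    and \<xi> :: real
    and u :: "real ^ 'n \<Rightarrow> real"
  assumes "CARD('n) \<ge> 2"
    and "bounded \<Omega>" and "open \<Omega>" and "connected \<Omega>"
    and "Ck_boundary 2 \<Omega>"
    and "f C1_differentiable_on UNIV"
    and "changes_sign f"
    and "f \<xi> = 0"
    and "\<And>t. f t * (t - \<xi>) \<le> 0"
    and "classical_neumann_solution f \<Omega> u"
  shows "u constant_on (closure \<Omega>)"
proof (cases "\<Omega> = {}")
  case True
  then show ?thesis by (simp add: constant_on_def)
next
  case False
  have dif: "u differentiable (at x)" if "x \<in> \<Omega>" for x
    using assms(10) that by (simp add: classical_neumann_solution_def numeral_2_eq_2)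
  have dif2: "partial_deriv b u differentiable (at x)" if "x \<in> \<Omega>" "b \<in> Basis" for x b
    using assms(10) that by (simp add: classical_neumann_solution_def numeral_2_eq_2)
  have contu: "continuous_on (closure \<Omega>) u"
    using assms(10) by (simp add: classical_neumann_solution_def C1_on_closure_def)
  have eq: "laplacian u x = - f (u x)" if "x \<in> \<Omega>" for x
    using assms(10) that by (force simp: classical_neumann_solution_def)
  have neumann: "has_normal_derivative u 0 \<Omega> p" if "p \<in> frontier \<Omega>" for p
    using assms(10) that by (simp add: classical_neumann_solution_def)
  define v where "v = (\<lambda>x. (u x - \<xi>)\<^sup>2)"
  \<comment> \<open>\<open>D\<close> and \<open>E\<close> are the first and second derivatives of
    \<open>v\<close> along \<open>b\<close> from the product rule, in the form the two subharmonic
    lemmas take.\<close>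
  define D where "D = (\<lambda>b x. 2 * (u x - \<xi>) * partial_deriv b u x)"
  define E where "E = (\<lambda>b x. 2 * (partial_deriv b u x)\<^sup>2
    + 2 * (u x - \<xi>) * partial_deriv b (partial_deriv b u) x)"
  have u1: "((\<lambda>s. u (x + s *\<^sub>R b)) has_real_derivative partial_deriv b u x) (at 0)"
    if "x \<in> \<Omega>" for x b
    using has_real_derivative_along_line[of u x 0 b] dif[OF that] by (simp add: partial_deriv_def)
  have u2: "((\<lambda>s. partial_deriv b u (x + s *\<^sub>R b)) has_real_derivative
      partial_deriv b (partial_deriv b u) x) (at 0)"
    if "x \<in> \<Omega>" "b \<in> Basis" for x b
    using has_real_derivative_along_line[of "partial_deriv b u" x 0 b] dif2[OF that]
    by (simp add: partial_deriv_def[of b "partial_deriv b u"])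
  have D: "((\<lambda>s. v (x + s *\<^sub>R b)) has_real_derivative D b x) (at 0)" if "x \<in> \<Omega>" for x b
    unfolding v_def D_def by (auto intro!: derivative_eq_intros u1 that)
  have E: "((\<lambda>s. D b (x + s *\<^sub>R b)) has_real_derivative E b x) (at 0)"
    if "x \<in> \<Omega>" "b \<in> Basis" for x b
    unfolding D_def E_def
    by (rule derivative_eq_intros refl u1 u2 that)+ (simp add: power2_eq_square algebra_simps)
  have subharmonic: "(\<Sum>b\<in>Basis. E b x) \<ge> 0" if "x \<in> \<Omega>" for x
  proof -
    have "(\<Sum>b\<in>Basis. E b x) = 2 * (\<Sum>b\<in>Basis. (partial_deriv b u x)\<^sup>2) + 2 * (u x - \<xi>) * laplacian u x"
      by (simp add: E_def laplacian_def sum.distrib sum_distrib_left)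
    also have "2 * (u x - \<xi>) * laplacian u x = - 2 * (f (u x) * (u x - \<xi>))"
      by (simp add: eq[OF that])
    also have "2 * (\<Sum>b\<in>Basis. (partial_deriv b u x)\<^sup>2) + - 2 * (f (u x) * (u x - \<xi>)) \<ge> 0"
      using assms(9)[of "u x"] sum_nonneg[of Basis "\<lambda>b. (partial_deriv b u x)\<^sup>2"] by simp
    finally show ?thesis .
  qed
  have contv: "continuous_on (closure \<Omega>) v"
    unfolding v_def by (intro continuous_intros contu)
  have "compact (closure \<Omega>)" using assms(2) by simp
  then obtain p where p: "p \<in> closure \<Omega>" "\<And>x. x \<in> closure \<Omega> \<Longrightarrow> v x \<le> v p"
    using continuous_attains_sup[OF _ _ contv] False by auto
  have le: "v x \<le> v p" if "x \<in> \<Omega>" for x using p(2) that closure_subset by blast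
  have "\<exists>z\<in>\<Omega>. v z = v p"
  proof (rule ccontr)
    assume "\<not> (\<exists>z\<in>\<Omega>. v z = v p)"
    then have less: "v x < v p" if "x \<in> \<Omega>" for x using le that by force
    then have pf: "p \<in> frontier \<Omega>" using p(1) assms(3) by (auto simp: frontier_def interior_open)
    define n where "n = outward_unit_normal \<Omega> p"
    obtain R where R: "R > 0" "ball (p - R *\<^sub>R n) R \<subseteq> \<Omega>" and n: "norm n = 1"
      using C2_boundary_interior_ball[OF assms(3,5) pf] unfolding n_def by blast
    define y where "y = p - R *\<^sub>R n"
    have sub: "ball y R \<subseteq> \<Omega>" using R by (simp add: y_def)
    have subc: "cball y R \<subseteq> closure \<Omega>"
      using closure_mono[OF sub] R(1) by (simp add: closure_ball)
    have "\<exists>c>0. \<forall>t. 0 < t \<and> t < 1/2 \<longrightarrow> v (p + t *\<^sub>R (y - p)) \<le> v p - c * t"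
    proof (rule hopf_boundary_point[where D = D and E = E])
      show "dist y p = R" using n R by (simp add: y_def dist_norm)
      show "continuous_on (cball y R) v" using contv subc continuous_on_subset by blast
    qed (use sub subc D E subharmonic less p R in blast)+
    then obtain c where c: "c > 0"
      "\<And>t. 0 < t \<Longrightarrow> t < 1/2 \<Longrightarrow> v (p + t *\<^sub>R (y - p)) \<le> v p - c * t" by blast
    define g where "g = (\<lambda>t. v (p + t *\<^sub>R n))"
    have "((\<lambda>t. u (p + t *\<^sub>R n)) has_real_derivative 0) (at_left 0)"
      using neumann[OF pf] by (simp add: has_normal_derivative_def n_def)
    then have "(g has_real_derivative 0) (at_left 0)"
      unfolding g_def v_def by (auto intro!: derivative_eq_intros)
    \<comment> \<open>As \<open>y - p\<close> is \<open>- R\<close> times \<open>n\<close>, Hopf's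
      bound reads \<open>g (- h) <= g 0 - (c / R) * h\<close>. The tilted function has negative left
      derivative, so just left of 0 it exceeds \<open>g 0\<close>, which contradicts this.\<close>
    then have "((\<lambda>t. g t - c / R * t) has_real_derivative 0 - c / R) (at_left 0)"
      by (intro derivative_intros DERIV_cmult_Id)
    moreover have "0 - c / R < 0" using c R by simp
    ultimately obtain \<delta> where \<delta>: "\<delta> > 0"
      "\<And>h. 0 < h \<Longrightarrow> 0 - h \<in> {..<0} \<Longrightarrow> h < \<delta> \<Longrightarrow> g 0 - c / R * 0 < g (0 - h) - c / R * (0 - h)"
      using has_real_derivative_neg_dec_left[of "\<lambda>t. g t - c / R * t" "0 - c / R" 0 "{..<0}"] by blast
    \<comment> \<open>\<open>h < R / 2\<close> brings the parameter \<open>h / R\<close> below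
      \<open>1/2\<close>, where Hopf's bound is available.\<close>
    define h where "h = min \<delta> (R / 2) / 2"
    have h: "0 < h" "h < \<delta>" "h < R / 2" using \<delta> R by (auto simp: h_def)
    have "v (p + (h / R) *\<^sub>R (y - p)) \<le> v p - c * (h / R)"
      using h R by (intro c(2)) (auto simp: field_simps)
    moreover have "p + (h / R) *\<^sub>R (y - p) = p + (- h) *\<^sub>R n" using R by (simp add: y_def)
    ultimately have "g (- h) \<le> g 0 - c * (h / R)" by (simp add: g_def)
    then show False using \<delta>(2)[of h] h by simp
  qed
  then obtain z where z: "z \<in> \<Omega>" "v z = v p" by blast
  have "v differentiable (at x)" if "x \<in> \<Omega>" for x
    unfolding v_def using dif[OF that] by (intro derivative_intros)
  then have v: "v x = v p" if "x \<in> \<Omega>" for x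
    using subharmonic_strong_maximum[of \<Omega> v D E "v p" z x] assms(3,4) D E subharmonic le z that
    by blast
  have "u ` \<Omega> \<subseteq> {\<xi> + sqrt (v p), \<xi> - sqrt (v p)}"
  proof (rule image_subsetI)
    fix x assume x: "x \<in> \<Omega>"
    have "sqrt (v x) = \<bar>u x - \<xi>\<bar>" by (simp add: v_def)
    then show "u x \<in> {\<xi> + sqrt (v p), \<xi> - sqrt (v p)}" using v[OF x] by auto
  qed
  then have "finite (u ` \<Omega>)" by (rule finite_subset) simp
  then have "u constant_on \<Omega>"
    using continuous_finite_range_constant[OF assms(4) continuous_on_subset[OF contu closure_subset]]
    by blast
  then show ?thesis using constant_on_closureI contu by blast
qed

end
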